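(* Let $n\ge 1$ and $0\le r\le n$ be integers, and let $S_{\lambda/\mu}\subseteq [n]\times[n]$ be a skew shape. Then there is a polynomial $f(q)$ in $q$ with nonnegative integer coefficients (depending only on $n$, $r$ and $S_{\lambda/\mu}$) such that for every prime power $q$ $$\mathrm{mat}_q(n,\overline{S_{\lambda/\mu}},r)=(q-1)^r f(q).$$
   Context: $[n]=\{1,\dots,n\}$. Positions in $[n]\times[n]$ are indexed in matrix coordinates (row, column). For $S\subseteq[n]\times[n]$, $\overline S=([n]\times[n])\setminus S$. For a prime power $q$, $\mathbf F_q$ is the field with $q$ elements, and $\mathrm{mat}_q(n,S,r)$ is the number of $n\times n$ matrices $A=(a_{ij})$ over $\mathbf F_q$ of rank $r$ such that $a_{ij}=0$ whenever $(i,j)\in S$. For a sequence of integers $n\ge\lambda_1\ge\lambda_2\ge\cdots\ge\lambda_n\ge 0$ (a partition $\lambda$), $S_\lambda=\{(i,j)\mid 1\le i\le n,\ 1\le j\le\lambda_i\}$. If $\lambda,\mu$ are two such partitions with $S_\mu\subseteq S_\lambda$, the set $S_{\lambda/\mu}=S_\lambda\setminus S_\mu$ is called a skew shape. *)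

theory Defs
  imports
    "Jordan_Normal_Form.Missing_VectorSpace"
    "HOL-Algebra.Ring_Divisibility"
    "HOL-Algebra.Weak_Morphisms"
    "HOL-Computational_Algebra.Polynomial"
    "HOL-Number_Theory.Prime_Powers"
begin

definition board :: "nat \<Rightarrow> (nat \<times> nat) set" where
  "board n = {1..n} \<times> {1..n}"

text \<open>A sequence \<open>n \<ge> \<lambda>\<^sub>1 \<ge> \<dots> \<ge> \<lambda>\<^sub>n \<ge> 0\<close> is a function on the naturals of which only the
  values at \<open>1, \<dots>, n\<close> matter.\<close>

definition partition_in_board :: "nat \<Rightarrow> (nat \<Rightarrow> nat) \<Rightarrow> bool" where
  "partition_in_board n lam \<longleftrightarrow>
     (\<forall>i\<in>{1..n}. lam i \<le> n) \<and> (\<forall>i\<in>{1..n}. \<forall>j\<in>{1..n}. i \<le> j \<longrightarrow> lam j \<le> lam i)"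

definition straight_shape :: "nat \<Rightarrow> (nat \<Rightarrow> nat) \<Rightarrow> (nat \<times> nat) set" where
  "straight_shape n lam = {(i, j). 1 \<le> i \<and> i \<le> n \<and> 1 \<le> j \<and> j \<le> lam i}"

definition skew_shape :: "nat \<Rightarrow> (nat \<times> nat) set \<Rightarrow> bool" where
  "skew_shape n S \<longleftrightarrow>
     (\<exists>lam mu. partition_in_board n lam \<and> partition_in_board n mu \<and>
        straight_shape n mu \<subseteq> straight_shape n lam \<and>
        S = straight_shape n lam - straight_shape n mu)"

text \<open>An \<open>n \<times> n\<close> matrix over \<open>F\<close> is an extensional function on the board, so that distinct
  functions are distinct matrices and they can be counted. Its rank is the dimension of the span
  of its columns in the space of functions from \<open>{1..n}\<close> to \<open>F\<close>.\<close>

definition matrices :: "('a, 'b) ring_scheme \<Rightarrow> nat \<Rightarrow> (nat \<times> nat \<Rightarrow> 'a) set" where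
  "matrices F n = board n \<rightarrow>\<^sub>E carrier F"

definition column :: "nat \<Rightarrow> (nat \<times> nat \<Rightarrow> 'a) \<Rightarrow> nat \<Rightarrow> (nat \<Rightarrow> 'a)" where
  "column n A j = (\<lambda>i\<in>{1..n}. A (i, j))"

definition mat_rank :: "('a, 'b) ring_scheme \<Rightarrow> nat \<Rightarrow> (nat \<times> nat \<Rightarrow> 'a) \<Rightarrow> nat" where
  "mat_rank F n A =
     (let V = ring.func_space F {1..n}
      in vectorspace.dim F
           (V\<lparr>carrier := LinearCombinations.module.span F V (column n A ` {1..n})\<rparr>))"

definition mat_count ::
    "('a, 'b) ring_scheme \<Rightarrow> nat \<Rightarrow> (nat \<times> nat) set \<Rightarrow> nat \<Rightarrow> nat" where
  "mat_count F n S r =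
     card {A \<in> matrices F n. mat_rank F n A = r \<and> (\<forall>(i, j)\<in>S. A (i, j) = \<zero>\<^bsub>F\<^esub>)}"

text \<open>A polynomial that has to serve all finite fields at once must be chosen before the field,
  so the fields have to be quantified inside a formula and hence over one fixed carrier type.
  The naturals are enough: every finite field, of whatever type, has an isomorphic copy there.\<close>

lemma finite_field_iso_nat:
  assumes "field R" and "finite (carrier R)"
  shows "\<exists>F :: nat ring. field F \<and> card (carrier F) = card (carrier R) \<and> R \<simeq> F"
proof -
  obtain h :: "_ \<Rightarrow> nat" where h: "inj_on h (carrier R)"
    using finite_imp_inj_to_nat_seg[OF assms(2)] by blast
  have "field (image_ring h R)"
    using field.inj_imp_image_ring_is_field[OF assms(1) h] .
  moreover have "R \<simeq> image_ring h R"
    using inj_imp_image_ring_iso[OF h] unfolding is_ring_iso_def by blast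
  moreover have "card (carrier (image_ring h R)) = card (carrier R)"
    using h by (simp add: image_ring_carrier card_image)
  ultimately show ?thesis
    by blast
qed

end

theory Submission
  imports Defs "Jordan_Normal_Form.DL_Rank"
begin

text \<open>
  Matrices supported in a skew shape can be counted by Gaussian elimination that never leaves the
  shape. Let \<open>(i, j)\<close> be the last cell of the topmost nonempty row of \<open>S\<close>, and split the
  matrices according to whether their entry there vanishes.

  If it does, what remains is a matrix supported in \<open>S - {(i, j)}\<close>. If it does not, it serves as a
  pivot: clearing row \<open>i\<close> and column \<open>j\<close> leaves the Schur complement, whose rank is smaller by one
  (\<open>mat_rank_schur_complement\<close>). Clearing changes an entry \<open>(k, l)\<close> elsewhere only if the entries
  at \<open>(i, l)\<close> and \<open>(k, j)\<close> are both nonzero, and for this choice of the pivot the cell \<open>(k, l)\<close> then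
  lies in \<open>S\<close>. Hence the Schur complement is an arbitrary matrix of rank \<open>r - 1\<close> supported in \<open>S\<close>
  without row \<open>i\<close> and column \<open>j\<close>, while the pivot is any of \<open>q - 1\<close> nonzero scalars and the \<open>h\<close>
  other entries in the row and the column of the pivot are free (\<open>card_pivot_nonzero\<close>). So the
  number \<open>N(S, r)\<close> of matrices of rank \<open>r\<close> satisfies
  \<open>N(S, r) = N(S - {(i, j)}, r) + (q - 1) q\<^sup>h N(S', r - 1)\<close>,
  where \<open>S'\<close> is \<open>S\<close> without row \<open>i\<close> and column \<open>j\<close>, and the second summand is absent for \<open>r = 0\<close>.
  Divided by \<open>(q - 1)\<^sup>r\<close>, this is a recursion with coefficients in \<open>\<nat>[q]\<close>, and the claim follows by
  induction on \<open>S\<close>. The pivots depend on the shape alone, which is why one polynomial serves all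
  fields.

  For a skew shape \<open>S\<close>, the set \<open>S - {(i, j)}\<close> is in general not a skew shape: its row \<open>i\<close> may end
  further to the left than the row below. The induction is therefore carried out for the larger
  class of shapes \<open>southwest_filled\<close>, which provides the cell \<open>(k, l)\<close> and is preserved by both
  deletions.
\<close>

section \<open>Rank of a pivoted matrix\<close>

text \<open>A maximal independent subset of \<open>X\<close>, extended by \<open>v\<close>, is a maximal independent subset of
  \<open>insert v X\<close>.\<close>

lemma (in vectorspace) dim_span_insert:
  assumes X: "X \<subseteq> carrier V" "finite X" and v: "v \<in> carrier V" "v \<notin> span X"
  shows "vectorspace.dim K (span_vs (insert v X)) = Suc (vectorspace.dim K (span_vs X))"
proof -
  have "lin_indpt {}"
    by (simp add: lin_dep_def)
  then obtain U where U: "finite U" "maximal U (\<lambda>T. T \<subseteq> X \<and> lin_indpt T)"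
    using maximal_exists_superset[of X "\<lambda>T. T \<subseteq> X \<and> lin_indpt T" "{}"] X(2) by auto
  then have UX: "U \<subseteq> X" and Uli: "lin_indpt U"
    and Umax: "\<And>T. U \<subseteq> T \<Longrightarrow> T \<subseteq> X \<Longrightarrow> lin_indpt T \<Longrightarrow> T = U"
    unfolding maximal_def by auto
  have vX: "v \<notin> X"
    using in_own_span[OF X(1)] v(2) by blast
  have "v \<notin> span U"
    using span_is_monotone[OF UX] v(2) by blast
  then have "lin_indpt (insert v U)"
    using lin_dep_iff_in_span[of U v] UX X(1) Uli v(1) vX by auto
  moreover have "T = insert v U" if T: "insert v U \<subseteq> T" "T \<subseteq> insert v X" "lin_indpt T" for T
  proof -
    have "T - {v} = U"
      using T vX UX subset_li_is_li[OF T(3), of "T - {v}"] by (intro Umax) auto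
    then show ?thesis using T(1) by blast
  qed
  ultimately have "maximal (insert v U) (\<lambda>T. T \<subseteq> insert v X \<and> lin_indpt T)"
    unfolding maximal_def using UX by blast
  then have "vectorspace.dim K (span_vs (insert v X)) = card (insert v U)"
    using dim_span X v(1) by simp
  also have "\<dots> = Suc (card U)"
    using U(1) UX vX by (intro card_insert_disjoint) auto
  finally show ?thesis
    using dim_span[OF X U(2)] by simp
qed

text \<open>The matrix keeps its size: its row \<open>i\<close> and column \<open>j\<close> become zero instead of being removed
  (\<open>schur_complement_pivot_lines\<close>), so that all matrices of the recursion live on one board.\<close>

definition schur_complement ::
    "('a, 'b) ring_scheme \<Rightarrow> nat \<Rightarrow> nat \<Rightarrow> nat \<Rightarrow> (nat \<times> nat \<Rightarrow> 'a) \<Rightarrow> nat \<times> nat \<Rightarrow> 'a" where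
  "schur_complement F n i j A =
     (\<lambda>(k, l)\<in>board n. A (k, l) \<ominus>\<^bsub>F\<^esub> inv\<^bsub>F\<^esub> A (i, j) \<otimes>\<^bsub>F\<^esub> A (i, l) \<otimes>\<^bsub>F\<^esub> A (k, j))"

lemma matrices_closed:
  "A \<in> matrices F n \<Longrightarrow> p \<in> board n \<Longrightarrow> A p \<in> carrier F"
  by (auto simp: matrices_def)

lemma board_iff: "(k, l) \<in> board n \<longleftrightarrow> k \<in> {1..n} \<and> l \<in> {1..n}"
  by (auto simp: board_def)

lemma (in field) inv_closed:
  assumes "c \<in> carrier R" "c \<noteq> \<zero>"
  shows "inv c \<in> carrier R" "inv c \<otimes> c = \<one>"
  using assms field_Units by auto

lemma (in field) schur_complement_closed:
  assumes A: "A \<in> matrices R n" and ij: "(i, j) \<in> board n" and nz: "A (i, j) \<noteq> \<zero>"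
  shows "schur_complement R n i j A \<in> matrices R n"
  using matrices_closed[OF A] ij inv_closed(1)[OF matrices_closed[OF A ij] nz]
  by (auto simp: schur_complement_def matrices_def board_iff)

lemma (in field) schur_complement_pivot_lines:
  assumes A: "A \<in> matrices R n" and ij: "(i, j) \<in> board n" and nz: "A (i, j) \<noteq> \<zero>"
    and kl: "(k, l) \<in> board n" and "k = i \<or> l = j"
  shows "schur_complement R n i j A (k, l) = \<zero>"
proof -
  note c = inv_closed[OF matrices_closed[OF A ij] nz]
  have cl: "A (i, j) \<in> carrier R" "A (i, l) \<in> carrier R" "A (k, j) \<in> carrier R"
    using matrices_closed[OF A] ij kl by (auto simp: board_iff)
  have eq: "schur_complement R n i j A (k, l) = A (k, l) \<ominus> inv A (i, j) \<otimes> A (i, l) \<otimes> A (k, j)"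
    using kl by (simp add: schur_complement_def)
  consider "k = i" | "l = j" using \<open>k = i \<or> l = j\<close> by blast
  then show ?thesis
  proof cases
    case 1
    have "inv A (i, j) \<otimes> A (i, l) \<otimes> A (i, j) = A (i, l) \<otimes> (inv A (i, j) \<otimes> A (i, j))"
      using cl c(1) by (simp add: m_ac)
    also have "\<dots> = A (i, l)"
      using cl c(2) by simp
    finally show ?thesis
      unfolding eq using 1 cl by (simp add: a_minus_def r_neg)
  next
    case 2
    then show ?thesis
      unfolding eq using cl c(2) by (simp add: a_minus_def r_neg)
  qed
qed

text \<open>Subtracting multiples of column \<open>j\<close> from the columns of \<open>A\<close> produces the columns of the
  complement \<open>B\<close>. Column \<open>j\<close> itself is thereby replaced by zero, so it has to be put back to
  recover the column space of \<open>A\<close>. It is not in the column space of \<open>B\<close>, all of whose vectors vanish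
  at \<open>i\<close>, and so it contributes one dimension.\<close>

lemma (in field) mat_rank_schur_complement:
  assumes A: "A \<in> matrices R n" and ij: "(i, j) \<in> board n" and nz: "A (i, j) \<noteq> \<zero>"
  shows "mat_rank R n A = Suc (mat_rank R n (schur_complement R n i j A))"
proof -
  define V where "V = (func_space {1..n} :: ('a, nat \<Rightarrow> 'a) module)"
  define B where "B = schur_complement R n i j A"
  interpret V: vectorspace R V
    using func_space_is_module field_axioms unfolding vectorspace_def V_def by blast
  have rank: "mat_rank R n M = vectorspace.dim R (V.span_vs (column n M ` {1..n}))" for M
    unfolding mat_rank_def V_def Let_def ..
  have B: "B \<in> matrices R n"
    unfolding B_def by (rule schur_complement_closed[OF assms])
  have col: "column n M l \<in> carrier V" if "M \<in> matrices R n" "l \<in> {1..n}" for M l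
    using matrices_closed[OF that(1)] that(2)
    by (auto simp: V_def func_space_def column_def board_iff)
  note c = inv_closed[OF matrices_closed[OF A ij] nz]
  define t where "t l = inv A (i, j) \<otimes> A (i, l)" for l
  have t: "t l \<in> carrier R" if "l \<in> {1..n}" for l
    using that ij c(1) matrices_closed[OF A] by (auto simp: t_def board_iff)
  have j: "j \<in> {1..n}" and i: "i \<in> {1..n}"
    using ij by (auto simp: board_iff)
  have Acol: "column n A l = column n B l \<oplus>\<^bsub>V\<^esub> t l \<odot>\<^bsub>V\<^esub> column n A j" if l: "l \<in> {1..n}" for l
  proof
    fix k
    show "column n A l k = (column n B l \<oplus>\<^bsub>V\<^esub> t l \<odot>\<^bsub>V\<^esub> column n A j) k"
    proof (cases "k \<in> {1..n}")
      case True
      have "A (k, l) \<in> carrier R" "A (k, j) \<in> carrier R"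
        using matrices_closed[OF A] True l j by (auto simp: board_iff)
      then have "A (k, l) = A (k, l) \<ominus> t l \<otimes> A (k, j) \<oplus> t l \<otimes> A (k, j)"
        using t[OF l] by (simp add: a_minus_def a_assoc l_neg)
      then show ?thesis
        using True l
        by (simp add: V_def func_space_def column_def B_def schur_complement_def t_def board_iff)
    qed (auto simp: V_def func_space_def column_def)
  qed
  have Bcol: "column n B l = column n A l \<oplus>\<^bsub>V\<^esub> (\<ominus> t l) \<odot>\<^bsub>V\<^esub> column n A j" if l: "l \<in> {1..n}" for l
    using Acol[OF l] col[OF A j] col[OF B l] t[OF l]
    by (simp add: V.smult_l_minus V.a_assoc V.r_neg)
  let ?CA = "column n A ` {1..n}" and ?CB = "column n B ` {1..n}"
  let ?X = "insert (column n A j) ?CB"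
  have CA: "?CA \<subseteq> carrier V" and CB: "?CB \<subseteq> carrier V" and X: "?X \<subseteq> carrier V"
    using col[OF A] col[OF B] j by auto
  have span: "V.span ?CA = V.span ?X"
  proof
    interpret S: submodule R "V.span ?X" V
      by (rule V.span_is_submodule[OF X])
    have "column n A l \<in> V.span ?X" if l: "l \<in> {1..n}" for l
    proof -
      have "column n B l \<in> V.span ?X" "column n A j \<in> V.span ?X"
        using V.in_own_span[OF X] l by blast+
      then show ?thesis
        unfolding Acol[OF l] using t[OF l] by blast
    qed
    then have "?CA \<subseteq> V.span ?X" by blast
    then show "V.span ?CA \<subseteq> V.span ?X"
      by (rule V.span_is_subset[OF _ V.span_is_submodule[OF X]])
  next
    interpret S: submodule R "V.span ?CA" V
      by (rule V.span_is_submodule[OF CA])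
    have "column n B l \<in> V.span ?CA" if l: "l \<in> {1..n}" for l
    proof -
      have "column n A l \<in> V.span ?CA" "column n A j \<in> V.span ?CA"
        using V.in_own_span[OF CA] l j by blast+
      then show ?thesis
        unfolding Bcol[OF l] using t[OF l] by blast
    qed
    then have "?X \<subseteq> V.span ?CA"
      using V.in_own_span[OF CA] j by blast
    then show "V.span ?X \<subseteq> V.span ?CA"
      by (rule V.span_is_subset[OF _ V.span_is_submodule[OF CA]])
  qed
  have notin: "column n A j \<notin> V.span ?CB"
  proof
    assume "column n A j \<in> V.span ?CB"
    moreover have "submodule R {v \<in> carrier V. v i = \<zero>} V"
      using i by unfold_locales (auto simp: V_def func_space_def)
    then have "V.span ?CB \<subseteq> {v \<in> carrier V. v i = \<zero>}"
      using schur_complement_pivot_lines[OF assms] CB i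
      by (intro V.span_is_subset) (auto simp: column_def board_iff B_def)
    ultimately have "column n A j i = \<zero>" by blast
    then show False using nz i by (simp add: column_def)
  qed
  have "mat_rank R n A = vectorspace.dim R (V.span_vs ?X)"
    by (simp only: rank span)
  also have "\<dots> = Suc (vectorspace.dim R (V.span_vs ?CB))"
    using V.dim_span_insert[OF CB _ col[OF A j] notin] by simp
  also have "\<dots> = Suc (mat_rank R n B)"
    by (simp only: rank)
  finally show ?thesis by (simp only: B_def)
qed

lemma (in field) mat_rank_zero:
  assumes "\<And>p. p \<in> board n \<Longrightarrow> A p = \<zero>"
  shows "mat_rank R n A = 0"
proof -
  define V where "V = (func_space {1..n} :: ('a, nat \<Rightarrow> 'a) module)"
  interpret V: vectorspace R V
    using func_space_is_module field_axioms unfolding vectorspace_def V_def by blast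
  have sub: "column n A ` {1..n} \<subseteq> {\<zero>\<^bsub>V\<^esub>}"
    using assms by (auto simp: V_def func_space_def column_def board_iff intro!: restrict_ext)
  have "T = {}" if T: "T \<subseteq> column n A ` {1..n}" "V.lin_indpt T" for T
  proof -
    have "T \<subseteq> {\<zero>\<^bsub>V\<^esub>}" using T(1) sub by blast
    then show ?thesis
      using V.vs_zero_lin_dep[OF _ T(2)] by blast
  qed
  moreover have "V.lin_indpt {}"
    by (simp add: V.lin_dep_def)
  ultimately have "maximal {} (\<lambda>T. T \<subseteq> column n A ` {1..n} \<and> V.lin_indpt T)"
    unfolding maximal_def by simp
  then have "vectorspace.dim R (V.span_vs (column n A ` {1..n})) = 0"
    using V.dim_span[of "column n A ` {1..n}" "{}"] subset_trans[OF sub] by simp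
  then show ?thesis
    unfolding mat_rank_def V_def Let_def .
qed

section \<open>Counting matrices by a pivot\<close>

definition supported_matrices ::
    "('a, 'b) ring_scheme \<Rightarrow> nat \<Rightarrow> (nat \<times> nat) set \<Rightarrow> nat \<Rightarrow> (nat \<times> nat \<Rightarrow> 'a) set" where
  "supported_matrices F n S r =
     {A \<in> matrices F n. mat_rank F n A = r \<and> (\<forall>p\<in>board n - S. A p = \<zero>\<^bsub>F\<^esub>)}"

lemma mat_count_supported:
  "mat_count F n (board n - S) r = card (supported_matrices F n S r)"
  unfolding mat_count_def supported_matrices_def by (auto intro: arg_cong[where f = card])

lemma finite_board [simp]: "finite (board n)"
  by (simp add: board_def)

lemma finite_supported_matrices:
  "finite (carrier F) \<Longrightarrow> finite (supported_matrices F n S r)"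
  unfolding supported_matrices_def matrices_def by (simp add: finite_PiE)

definition hook :: "(nat \<times> nat) set \<Rightarrow> nat \<Rightarrow> nat \<Rightarrow> (nat \<times> nat) set" where
  "hook S i j = {(k, l) \<in> S. (k = i \<or> l = j) \<and> (k, l) \<noteq> (i, j)}"

definition delete_lines :: "(nat \<times> nat) set \<Rightarrow> nat \<Rightarrow> nat \<Rightarrow> (nat \<times> nat) set" where
  "delete_lines S i j = {(k, l) \<in> S. k \<noteq> i \<and> l \<noteq> j}"

text \<open>A matrix with a nonzero entry at \<open>(i, j)\<close> is determined by that entry, by the rest of its row
  and column, and by its Schur complement. The hypothesis \<open>fill\<close> makes these data independent of
  each other: the correction at \<open>(k, l)\<close> is a multiple of \<open>A (i, l) \<otimes> A (k, j)\<close> and so can be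
  nonzero only at cells of the shape. Off the row and column of the pivot, the matrix therefore
  vanishes outside \<open>S\<close> if and only if its complement does.\<close>

lemma (in field) card_pivot_nonzero:
  assumes fin: "finite (carrier R)" and S: "S \<subseteq> board n" and ij: "(i, j) \<in> S"
    and fill: "\<And>k l. (i, l) \<in> S \<Longrightarrow> (k, j) \<in> S \<Longrightarrow> (k, l) \<in> S"
  shows "card {A \<in> supported_matrices R n S (Suc r). A (i, j) \<noteq> \<zero>} =
    (card (carrier R) - 1) * card (carrier R) ^ card (hook S i j) *
      card (supported_matrices R n (delete_lines S i j) r)" (is "card ?L = _")
proof -
  let ?H = "hook S i j" and ?S' = "delete_lines S i j"
  let ?R = "(carrier R - {\<zero>}) \<times> (?H \<rightarrow>\<^sub>E carrier R) \<times> supported_matrices R n ?S' r"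
  define f where "f A = (A (i, j), restrict A ?H, schur_complement R n i j A)" for A
  define h' where "h' c h p = (if p = (i, j) then c else if p \<in> ?H then h p else \<zero>)"
    for c :: 'a and h :: "nat \<times> nat \<Rightarrow> 'a" and p
  \<comment> \<open>the inverse of \<open>f\<close>, which adds the correction by the pivot back to the complement\<close>
  define g where "g = (\<lambda>(c, h, B). \<lambda>(k, l)\<in>board n.
    if k = i \<or> l = j then h' c h (k, l)
    else B (k, l) \<oplus> inv c \<otimes> h' c h (i, l) \<otimes> h' c h (k, j))"
  have ijb: "(i, j) \<in> board n" using S ij by blast
  have Hb: "?H \<subseteq> board n" and finH: "finite ?H"
    using S by (auto simp: hook_def intro: finite_subset[OF _ finite_board[of n]])
  have h'_closed: "h' c h p \<in> carrier R" if "c \<in> carrier R" "h \<in> ?H \<rightarrow>\<^sub>E carrier R" for c h p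
    using that by (auto simp: h'_def)
  have fL: "f A \<in> ?R" and gf: "g (f A) = A" if A: "A \<in> ?L" for A
  proof -
    let ?B = "schur_complement R n i j A"
    have Am: "A \<in> matrices R n" and nz: "A (i, j) \<noteq> \<zero>" and rk: "mat_rank R n A = Suc r"
      and z: "\<And>p. p \<in> board n \<Longrightarrow> p \<notin> S \<Longrightarrow> A p = \<zero>"
      using A by (auto simp: supported_matrices_def)
    note cl = matrices_closed[OF Am]
    note c = inv_closed[OF cl[OF ijb] nz]
    have "mat_rank R n ?B = r"
      using mat_rank_schur_complement[OF Am ijb nz] rk by simp
    moreover have "?B p = \<zero>" if p: "p \<in> board n - ?S'" for p
    proof -
      obtain k l where kl: "p = (k, l)" by (cases p)
      show ?thesis
      proof (cases "k = i \<or> l = j")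
        case True
        then show ?thesis
          using schur_complement_pivot_lines[OF Am ijb nz] p kl by auto
      next
        case False
        then have notS: "(k, l) \<notin> S" using p kl by (auto simp: delete_lines_def)
        then have "(i, l) \<notin> S \<or> (k, j) \<notin> S" using fill by blast
        then have "A (i, l) = \<zero> \<or> A (k, j) = \<zero>"
          using z p kl ijb by (auto simp: board_iff)
        moreover have "A (i, l) \<in> carrier R" "A (k, j) \<in> carrier R"
          using cl p kl ijb by (auto simp: board_iff)
        ultimately show ?thesis
          using z[of p] p kl notS c by (auto simp: schur_complement_def)
      qed
    qed
    ultimately show "f A \<in> ?R"
      using nz cl ijb Hb schur_complement_closed[OF Am ijb nz]
      by (auto simp: f_def supported_matrices_def)
    have h': "h' (A (i, j)) (restrict A ?H) (k, l) = A (k, l)"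
      if "(k, l) \<in> board n" "k = i \<or> l = j" for k l
      using that z by (auto simp: h'_def hook_def)
    show "g (f A) = A"
    proof
      fix p :: "nat \<times> nat"
      obtain k l where kl: "p = (k, l)" by (cases p)
      show "g (f A) p = A p"
      proof (cases "p \<in> board n")
        case True
        then have il: "(i, l) \<in> board n" and kj: "(k, j) \<in> board n"
          using ijb kl by (auto simp: board_iff)
        have "A (k, l) \<ominus> inv A (i, j) \<otimes> A (i, l) \<otimes> A (k, j)
            \<oplus> inv A (i, j) \<otimes> A (i, l) \<otimes> A (k, j) = A (k, l)"
          using cl[OF il] cl[OF kj] cl[OF True] kl c
          by (simp add: a_minus_def a_assoc l_neg)
        then show ?thesis
          using True kl h' il kj by (auto simp: f_def g_def schur_complement_def)
      next
        case False
        then show ?thesis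
          using Am kl by (auto simp: f_def g_def matrices_def)
      qed
    qed
  qed
  have gR: "g x \<in> ?L" and fg: "f (g x) = x" if x: "x \<in> ?R" for x
  proof -
    obtain c h B where xe: "x = (c, h, B)" by (cases x)
    have cc: "c \<in> carrier R" "c \<noteq> \<zero>" and h: "h \<in> ?H \<rightarrow>\<^sub>E carrier R"
      and Bm: "B \<in> matrices R n" and Brk: "mat_rank R n B = r"
      and Bz: "\<And>p. p \<in> board n \<Longrightarrow> p \<notin> ?S' \<Longrightarrow> B p = \<zero>"
      using x xe by (auto simp: supported_matrices_def)
    note ic = inv_closed[OF cc]
    let ?A = "g x"
    have gx: "?A (k, l) = (if k = i \<or> l = j then h' c h (k, l)
        else B (k, l) \<oplus> inv c \<otimes> h' c h (i, l) \<otimes> h' c h (k, j))" if "(k, l) \<in> board n" for k l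
      using that by (simp add: g_def xe)
    have Am: "?A \<in> matrices R n"
      using h'_closed[OF cc(1) h] ic matrices_closed[OF Bm]
      by (auto simp: matrices_def g_def xe)
    have Aij: "?A (i, j) = c"
      using ijb by (simp add: gx h'_def)
    have sch: "schur_complement R n i j ?A = B"
    proof
      fix p :: "nat \<times> nat"
      obtain k l where kl: "p = (k, l)" by (cases p)
      show "schur_complement R n i j ?A p = B p"
      proof (cases "p \<in> board n")
        case True
        then have il: "(i, l) \<in> board n" and kj: "(k, j) \<in> board n"
          using ijb kl by (auto simp: board_iff)
        show ?thesis
        proof (cases "k = i \<or> l = j")
          case True
          then have "B p = \<zero>"
            using Bz[of p] \<open>p \<in> board n\<close> kl by (auto simp: delete_lines_def)
          then show ?thesis
            using schur_complement_pivot_lines[OF Am ijb, of k l] Aij cc True kl \<open>p \<in> board n\<close>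
            by simp
        next
          case False
          have "B (k, l) \<oplus> inv c \<otimes> h' c h (i, l) \<otimes> h' c h (k, j)
              \<ominus> inv c \<otimes> h' c h (i, l) \<otimes> h' c h (k, j) = B (k, l)"
            using h'_closed[OF cc(1) h] ic matrices_closed[OF Bm True] kl
            by (simp add: a_minus_def a_assoc r_neg)
          then show ?thesis
            using False True kl gx[of k l] gx[OF il] gx[OF kj] Aij
            by (simp add: schur_complement_def)
        qed
      next
        case False
        then show ?thesis
          using Bm by (auto simp: schur_complement_def matrices_def)
      qed
    qed
    have "mat_rank R n ?A = Suc r"
      using mat_rank_schur_complement[OF Am ijb] Aij cc sch Brk by simp
    moreover have "?A p = \<zero>" if p: "p \<in> board n - S" for p
    proof -
      obtain k l where kl: "p = (k, l)" by (cases p)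
      have "(i, l) \<notin> S \<or> (k, j) \<notin> S" using fill p kl by blast
      then have "h' c h (i, l) = \<zero> \<or> h' c h (k, j) = \<zero>" if "k \<noteq> i" "l \<noteq> j"
        using that by (auto simp: h'_def hook_def)
      moreover have "h' c h (k, l) = \<zero>"
        using p kl ij by (auto simp: h'_def hook_def)
      moreover have "B (k, l) = \<zero>"
        using Bz[of "(k, l)"] p kl by (auto simp: delete_lines_def)
      ultimately show ?thesis
        using p kl gx[of k l] h'_closed[OF cc(1) h] ic by auto
    qed
    ultimately show "?A \<in> ?L"
      using Am Aij cc by (simp add: supported_matrices_def)
    have "restrict ?A ?H = h"
    proof
      fix p :: "nat \<times> nat"
      obtain k l where kl: "p = (k, l)" by (cases p)
      show "restrict ?A ?H p = h p"
      proof (cases "p \<in> ?H")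
        case True
        then have "(k, l) \<in> board n" "k = i \<or> l = j" "(k, l) \<noteq> (i, j)"
          using Hb kl by (auto simp: hook_def)
        then show ?thesis
          using True kl gx[of k l] by (auto simp: h'_def)
      next
        case False
        then show ?thesis
          using h by auto
      qed
    qed
    then show "f ?A = x"
      using sch Aij by (simp add: f_def xe)
  qed
  have "bij_betw f ?L ?R"
    by (rule bij_betw_byWitness[where f' = g]) (use fL gf gR fg in blast)+
  then have "card ?L = card ?R"
    by (rule bij_betw_same_card)
  also have "\<dots> = (card (carrier R) - 1) * (card (carrier R) ^ card ?H *
      card (supported_matrices R n ?S' r))"
    using fin finH by (simp add: card_cartesian_product card_PiE)
  finally show ?thesis by (simp add: mult.assoc)
qed

lemma supported_matrices_pivot_zero:
  assumes "S \<subseteq> board n" "(i, j) \<in> S"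
  shows "{A \<in> supported_matrices F n S r. A (i, j) = \<zero>\<^bsub>F\<^esub>} = supported_matrices F n (S - {(i, j)}) r"
  using assms by (auto simp: supported_matrices_def)

lemma card_supported_split:
  assumes "finite (carrier F)" "S \<subseteq> board n" "(i, j) \<in> S"
  shows "card (supported_matrices F n S r) =
    card (supported_matrices F n (S - {(i, j)}) r) +
    card {A \<in> supported_matrices F n S r. A (i, j) \<noteq> \<zero>\<^bsub>F\<^esub>}"
proof -
  let ?M = "supported_matrices F n S r"
  let ?Z = "{A \<in> ?M. A (i, j) = \<zero>\<^bsub>F\<^esub>}" and ?N = "{A \<in> ?M. A (i, j) \<noteq> \<zero>\<^bsub>F\<^esub>}"
  have "finite ?Z" "finite ?N"
    using finite_supported_matrices[OF assms(1), of n S r] by simp_all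
  then have "card (?Z \<union> ?N) = card ?Z + card ?N"
    by (rule card_Un_disjoint) blast
  moreover have "?Z \<union> ?N = ?M"
    by blast
  ultimately show ?thesis
    by (simp only: supported_matrices_pivot_zero[OF assms(2,3)])
qed

lemma (in field) supported_matrices_rank0_nonzero:
  assumes "(i, j) \<in> board n"
  shows "{A \<in> supported_matrices R n S 0. A (i, j) \<noteq> \<zero>} = {}"
  using mat_rank_schur_complement[OF _ assms] by (auto simp: supported_matrices_def)

lemma (in field) card_supported_empty:
  "card (supported_matrices R n {} r) = (if r = 0 then 1 else 0)"
proof -
  let ?Z = "\<lambda>p\<in>board n. \<zero>"
  have "supported_matrices R n {} r = (if r = 0 then {?Z} else {})"
    using mat_rank_zero[of n ?Z] mat_rank_zero
    by (auto simp: supported_matrices_def matrices_def PiE_def extensional_def fun_eq_iff)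
  then show ?thesis by simp
qed

section \<open>Shapes closed under pivoting\<close>

text \<open>If the three cells \<open>(i, j')\<close>, \<open>(i, j)\<close>, \<open>(i', j)\<close> of a rectangle belong to the shape, then so
  does its lower left cell \<open>(i', j')\<close>. When \<open>(i, j)\<close> is the last cell of its row and the topmost
  of its column, these lower left cells are all that changes when it is used as a pivot.\<close>

definition southwest_filled :: "(nat \<times> nat) set \<Rightarrow> bool" where
  "southwest_filled S \<longleftrightarrow> (\<forall>i i' j j'. i < i' \<longrightarrow> j' < j \<longrightarrow>
     (i, j') \<in> S \<longrightarrow> (i, j) \<in> S \<longrightarrow> (i', j) \<in> S \<longrightarrow> (i', j') \<in> S)"

text \<open>In a skew shape \<open>(i', j')\<close> lies to the left of \<open>(i', j)\<close>, hence in \<open>\<lambda>\<close>, and below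
  \<open>(i, j')\<close>, hence outside \<open>\<mu>\<close>.\<close>

lemma skew_shape_southwest_filled:
  assumes "skew_shape n S"
  shows "S \<subseteq> board n" "southwest_filled S"
proof -
  obtain lam mu where lam: "partition_in_board n lam" and mu: "partition_in_board n mu"
    and S: "S = straight_shape n lam - straight_shape n mu"
    using assms by (auto simp: skew_shape_def)
  show "S \<subseteq> board n"
  proof
    fix p assume "p \<in> S"
    moreover obtain i j where "p = (i, j)" by (cases p)
    ultimately have "1 \<le> i" "i \<le> n" "1 \<le> j" "j \<le> lam i" and p: "p = (i, j)"
      by (auto simp: S straight_shape_def)
    moreover have "lam i \<le> n"
      using calculation lam by (simp add: partition_in_board_def)
    ultimately show "p \<in> board n"
      by (simp add: board_iff)
  qed
  show "southwest_filled S"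
    unfolding southwest_filled_def
  proof (intro allI impI)
    fix i i' j j'
    assume less: "i < i'" "j' < j" and cells: "(i, j') \<in> S" "(i, j) \<in> S" "(i', j) \<in> S"
    then have "mu i' \<le> mu i"
      using mu by (auto simp: S straight_shape_def partition_in_board_def)
    then show "(i', j') \<in> S"
      using less cells by (auto simp: S straight_shape_def)
  qed
qed

text \<open>The last cell of the topmost nonempty row is a pivot as required by \<open>card_pivot_nonzero\<close>.
  Deleting it preserves the property because it lies below no other cell, so the property never
  requires it to be present.\<close>

lemma southwest_filled_corner:
  assumes fin: "finite S" and ne: "S \<noteq> {}" and sw: "southwest_filled S"
  obtains i j where "(i, j) \<in> S" "southwest_filled (S - {(i, j)})"
    "\<And>k l. (i, l) \<in> S \<Longrightarrow> (k, j) \<in> S \<Longrightarrow> (k, l) \<in> S"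
proof -
  define i where "i = Min (fst ` S)"
  define j where "j = Max {l. (i, l) \<in> S}"
  have "i \<in> fst ` S" and i: "\<And>k l. (k, l) \<in> S \<Longrightarrow> i \<le> k"
    unfolding i_def using fin ne by (auto simp: rev_image_eqI)
  moreover have "finite {l. (i, l) \<in> S}"
    by (rule finite_subset[of _ "snd ` S"]) (use fin in force)+
  moreover have "{l. (i, l) \<in> S} \<noteq> {}"
    using \<open>i \<in> fst ` S\<close> by force
  ultimately have ij: "(i, j) \<in> S" and j: "\<And>l. (i, l) \<in> S \<Longrightarrow> l \<le> j"
    using Max_in[of "{l. (i, l) \<in> S}"] unfolding j_def by auto
  have "southwest_filled (S - {(i, j)})"
    using sw i unfolding southwest_filled_def
    by (metis Diff_iff fst_conv insert_iff leD singletonD)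
  moreover have "(k, l) \<in> S" if "(i, l) \<in> S" "(k, j) \<in> S" for k l
  proof (cases "k = i \<or> l = j")
    case False
    then have "i < k" "l < j"
      using i[OF that(2)] j[OF that(1)] by auto
    then show ?thesis
      using sw ij that unfolding southwest_filled_def by blast
  qed (use that in auto)
  ultimately show thesis
    using that ij by blast
qed

lemma southwest_filled_delete_lines:
  "southwest_filled S \<Longrightarrow> southwest_filled (delete_lines S i j)"
  by (auto simp: southwest_filled_def delete_lines_def)

text \<open>The recursion of the introduction, turned into one for the quotient by \<open>(q - 1)\<^sup>r\<close>: in the
  second summand the pivot supplies one factor \<open>q - 1\<close> and the induction hypothesis for \<open>r - 1\<close> the
  others, and what is left over is the monomial \<open>q\<^sup>h\<close>.\<close>

theorem rank_count_southwest_filled: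
  fixes n r :: nat
  assumes "S \<subseteq> board n" and "southwest_filled S"
  shows "\<exists>f :: int poly. (\<forall>k. coeff f k \<ge> 0) \<and>
    (\<forall>F :: ('a, 'b) ring_scheme. field F \<longrightarrow> finite (carrier F) \<longrightarrow>
       int (card (supported_matrices F n S r)) =
         (int (card (carrier F)) - 1) ^ r * poly f (int (card (carrier F))))"
  using finite_subset[OF assms(1) finite_board] assms
proof (induction S arbitrary: r rule: finite_psubset_induct)
  case (psubset S)
  show ?case
  proof (cases "S = {}")
    case True
    then show ?thesis
      by (intro exI[of _ "if r = 0 then 1 else 0"]) (simp add: field.card_supported_empty)
  next
    case False
    obtain i j where ij: "(i, j) \<in> S" and sw: "southwest_filled (S - {(i, j)})"
      and fill: "\<And>k l. (i, l) \<in> S \<Longrightarrow> (k, j) \<in> S \<Longrightarrow> (k, l) \<in> S"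
      using southwest_filled_corner[OF psubset.hyps False psubset.prems(2)] by metis
    let ?q = "\<lambda>F :: ('a, 'b) ring_scheme. int (card (carrier F))"
    obtain f where f: "\<forall>k. coeff f k \<ge> 0" and f_count:
      "\<And>F :: ('a, 'b) ring_scheme. field F \<Longrightarrow> finite (carrier F) \<Longrightarrow>
         int (card (supported_matrices F n (S - {(i, j)}) r)) = (?q F - 1) ^ r * poly f (?q F)"
      using psubset.IH[of "S - {(i, j)}" r] psubset.prems(1) sw ij by blast
    note split = card_supported_split[OF _ psubset.prems(1) ij]
    show ?thesis
    proof (cases r)
      case 0
      have "int (card (supported_matrices F n S r)) = (?q F - 1) ^ r * poly f (?q F)"
        if F: "field F" "finite (carrier F)" for F :: "('a, 'b) ring_scheme"
      proof -
        have "(i, j) \<in> board n" using ij psubset.prems(1) by blast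
        from field.supported_matrices_rank0_nonzero[OF F(1) this, of S]
        have "card {A \<in> supported_matrices F n S r. A (i, j) \<noteq> \<zero>\<^bsub>F\<^esub>} = 0"
          unfolding 0 by (simp only: card.empty)
        with split[OF F(2), of r] f_count[OF F] show ?thesis
          by (simp only: add_0_right)
      qed
      then show ?thesis using f by blast
    next
      case (Suc s)
      have "delete_lines S i j \<subset> S"
        using ij by (auto simp: delete_lines_def)
      then obtain g where g: "\<forall>k. coeff g k \<ge> 0" and g_count:
        "\<And>F :: ('a, 'b) ring_scheme. field F \<Longrightarrow> finite (carrier F) \<Longrightarrow>
           int (card (supported_matrices F n (delete_lines S i j) s)) =
             (?q F - 1) ^ s * poly g (?q F)"
        using psubset.IH[of "delete_lines S i j" s] psubset.prems
          southwest_filled_delete_lines[OF psubset.prems(2)] by blast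
      define h where "h = f + monom 1 (card (hook S i j)) * g"
      have "\<forall>k. coeff h k \<ge> 0"
        using f g by (simp add: h_def coeff_monom_mult)
      moreover have "int (card (supported_matrices F n S r)) = (?q F - 1) ^ r * poly h (?q F)"
        if F: "field F" "finite (carrier F)" for F :: "('a, 'b) ring_scheme"
      proof -
        have "card (carrier F) > 0"
          using F by (metis card_gt_0_iff empty_iff field.is_ring ring.ring_simprules(2))
        then have "int (card (carrier F) - 1) = ?q F - 1"
          by simp
        moreover have "card {A \<in> supported_matrices F n S (Suc s). A (i, j) \<noteq> \<zero>\<^bsub>F\<^esub>} =
            (card (carrier F) - 1) * card (carrier F) ^ card (hook S i j) *
              card (supported_matrices F n (delete_lines S i j) s)"
          using field.card_pivot_nonzero[OF F psubset.prems(1) ij] fill by blast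
        ultimately have "int (card {A \<in> supported_matrices F n S r. A (i, j) \<noteq> \<zero>\<^bsub>F\<^esub>}) =
            (?q F - 1) * ?q F ^ card (hook S i j) * ((?q F - 1) ^ s * poly g (?q F))"
          using g_count[OF F] Suc by (simp only: of_nat_mult of_nat_power)
        then show ?thesis
          using split[OF F(2), of r] f_count[OF F]
          by (simp add: h_def Suc poly_monom algebra_simps)
      qed
      ultimately show ?thesis by blast
    qed
  qed
qed

theorem corollary4p6:
  fixes n r :: nat and S :: "(nat \<times> nat) set"
  assumes "n \<ge> 1" and "r \<le> n" and "skew_shape n S"
  shows "\<exists>f :: int poly. (\<forall>k. coeff f k \<ge> 0) \<and>
    (\<forall>(q :: nat) (F :: nat ring).
       primepow q \<longrightarrow> field F \<longrightarrow> card (carrier F) = q \<longrightarrow>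
       int (mat_count F n (board n - S) r) = (int q - 1) ^ r * poly f (int q))"
proof -
  obtain f :: "int poly" where f: "\<forall>k. coeff f k \<ge> 0"
    and count: "\<And>F :: nat ring. field F \<Longrightarrow> finite (carrier F) \<Longrightarrow>
       int (card (supported_matrices F n S r)) =
         (int (card (carrier F)) - 1) ^ r * poly f (int (card (carrier F)))"
    using rank_count_southwest_filled[OF skew_shape_southwest_filled[OF assms(3)]] by blast
  have "finite (carrier F)" if "primepow (card (carrier F))" for F :: "nat ring"
    using primepow_gt_0_nat[OF that] card_ge_0_finite by blast
  then show ?thesis
    using f count by (auto simp: mat_count_supported intro!: exI[of _ f])
qed

end
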